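(* Let $n > 5$ be an integer, let $P_n$ be the Pancake graph on $S_n$ with identity vertex $I_n$, and let $$M = \{u \in S_n \mid d_{P_n}(I_n,u) \geq \mathrm{diam}(P_{n-1})\}.$$ Let $d_n = \max\{ d_{P_n}(u,v) \mid u,v \in M\}$ be the maximum of the distances in $P_n$ between vertices of $M$. Then $$\mathrm{diam}(P_n) \leq \mathrm{diam}(P_{n-1}) + d_n.$$
   Context: Write a permutation $\pi\in S_n$ of $\{1,\dots,n\}$ in one-line notation $\pi = [\pi_1 \pi_2 \dots \pi_n]$. For $2 \le i \le n$ the prefix reversal $r_i$ acts on the right by $[\pi_1 \pi_2 \dots \pi_{i-1}\pi_i \pi_{i+1}\dots \pi_n] r_i = [\pi_i \pi_{i-1} \dots \pi_2 \pi_1 \pi_{i+1} \dots \pi_n]$. The Pancake graph $P_n$ is the simple graph with vertex set $S_n$ in which $\pi$ and $\sigma$ are adjacent if and only if $\sigma = \pi r_i$ for some $2\le i\le n$ (the Cayley graph of $S_n$ with respect to the set of all prefix reversals $\{r_2,\dots,r_n\}$). $I_n$ denotes the identity permutation, $d_{P_n}$ the graph (shortest path) distance, and $\mathrm{diam}$ the maximum distance between two vertices. *)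

theory Defs
  imports
    "HOL-Combinatorics.Permutations"
    "Graph_Theory.Pair_Digraph"
    "Graph_Theory.Shortest_Path"
begin

definition prefix_reversal :: "nat \<Rightarrow> nat \<Rightarrow> nat"
  where "prefix_reversal i j = (if 1 \<le> j \<and> j \<le> i then i + 1 - j else j)"

text \<open>
  The one-line notation of a permutation \<open>\<pi>\<close> of \<open>{1..n}\<close> is \<open>[\<pi> 1, \<dots>, \<pi> n]\<close>, so the right
  action of the prefix reversal is composition on the right (see \<open>one_line_prefix_reversal\<close>).
  An undirected edge is represented by its two opposite arcs.
\<close>

definition pancake_graph :: "nat \<Rightarrow> (nat \<Rightarrow> nat) pair_pre_digraph"
  where "pancake_graph n =
    \<lparr> pverts = {\<pi>. \<pi> permutes {1..n}},
      parcs = {(\<pi>, \<sigma>). \<pi> permutes {1..n} \<and> (\<exists>i\<in>{2..n}. \<sigma> = \<pi> \<circ> prefix_reversal i)} \<rparr>"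

text \<open>With unit weights, the cost of a walk is its length, so \<open>\<mu>\<close> is the usual graph distance.\<close>

definition graph_dist :: "'a pair_pre_digraph \<Rightarrow> 'a \<Rightarrow> 'a \<Rightarrow> ereal"
  where "graph_dist G u v = wf_digraph.\<mu> (with_proj G) (\<lambda>_. 1) u v"

definition graph_diameter :: "'a pair_pre_digraph \<Rightarrow> ereal"
  where "graph_diameter G = Max {graph_dist G u v | u v. u \<in> pverts G \<and> v \<in> pverts G}"

lemma one_line_prefix_reversal:
  assumes "i \<le> n"
  shows "map (\<pi> \<circ> prefix_reversal i) [1..<n+1] =
    rev (take i (map \<pi> [1..<n+1])) @ drop i (map \<pi> [1..<n+1])"
  using assms
  by (intro nth_equalityI) (auto simp: prefix_reversal_def nth_append rev_nth Suc_diff_Suc simp del: upt_Suc)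

lemma prefix_reversal_involution: "prefix_reversal i \<circ> prefix_reversal i = id"
  by (auto simp: prefix_reversal_def fun_eq_iff)

lemma prefix_reversal_permutes:
  assumes "i \<le> n"
  shows "prefix_reversal i permutes {1..n}"
proof (rule bij_imp_permutes)
  have "bij (prefix_reversal i)"
    using prefix_reversal_involution o_bij by blast
  moreover have "prefix_reversal i ` {1..n} \<subseteq> {1..n}"
    using assms by (auto simp: prefix_reversal_def)
  ultimately show "bij_betw (prefix_reversal i) {1..n} {1..n}"
    by (metis bij_betw_def bij_is_inj endo_inj_surj finite_atLeastAtMost inj_on_subset subset_UNIV)
qed (use assms in \<open>auto simp: prefix_reversal_def\<close>)

lemma pair_graph_pancake_graph: "pair_graph (pancake_graph n)"
proof
  let ?G = "pancake_graph n"
  have fst_in: "fst e \<in> pverts ?G" and snd_in: "snd e \<in> pverts ?G" if "e \<in> parcs ?G" for e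
    using that permutes_compose[OF prefix_reversal_permutes]
    by (auto simp: pancake_graph_def)
  show "fst e \<in> pverts ?G" "snd e \<in> pverts ?G" if "e \<in> parcs ?G" for e
    using fst_in snd_in that by auto
  show fin: "finite (pverts ?G)"
    by (simp add: pancake_graph_def finite_permutations)
  have "parcs ?G \<subseteq> pverts ?G \<times> pverts ?G"
    using fst_in snd_in by (metis mem_Times_iff subsetI)
  with fin show "finite (parcs ?G)"
    by (meson finite_SigmaI finite_subset)
  show "fst e \<noteq> snd e" if "e \<in> parcs ?G" for e
  proof
    assume "fst e = snd e"
    with that obtain \<pi> i where p: "\<pi> permutes {1..n}" "i \<ge> 2" "\<pi> = \<pi> \<circ> prefix_reversal i"
      by (auto simp: pancake_graph_def)
    from p(3) have "\<pi> 1 = \<pi> (prefix_reversal i 1)"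
      by (metis comp_apply)
    with p(1) have "1 = prefix_reversal i 1"
      by (metis permutes_inj injD)
    with p(2) show False
      by (simp add: prefix_reversal_def)
  qed
  have "(v, u) \<in> parcs ?G" if "(u, v) \<in> parcs ?G" for u v
  proof -
    from that obtain i where i: "i \<in> {2..n}" "v = u \<circ> prefix_reversal i"
      by (auto simp: pancake_graph_def)
    then have "u = v \<circ> prefix_reversal i"
      by (simp add: comp_assoc prefix_reversal_involution)
    with i snd_in[OF that] show ?thesis
      by (auto simp: pancake_graph_def)
  qed
  then show "symmetric (with_proj ?G)"
    by (auto simp: symmetric_def intro: symI)
qed

end

theory Submission
  imports Defs
begin

text \<open>
  Write \<open>D\<close> for the diameter of \<open>P\<^bsub>n-1\<^esub>\<close>.  Two prefix reversals bring the value \<open>n\<close> to the last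
  position, and the rest can then be sorted inside \<open>P\<^bsub>n-1\<^esub>\<close>; hence the diameter of \<open>P\<^sub>n\<close> is at most
  \<open>D + 2\<close> (\<open>pancake_diameter_le_plus_2\<close>).  It is at least \<open>D\<close>, because deleting the value \<open>n\<close> from
  the one-line notation turns walks of \<open>P\<^sub>n\<close> into walks of \<open>P\<^bsub>n-1\<^esub>\<close> that are no longer
  (\<open>pancake_diameter_mono\<close>).  So the diameter of \<open>P\<^sub>n\<close> is \<open>D + e\<close> with \<open>e \<le> 2\<close>, and it suffices to find
  two vertices of \<open>M\<close> at distance at least \<open>e\<close>.

  Let \<open>\<sigma>\<close> be a vertex farthest from the identity.  It belongs to \<open>M\<close>, which settles \<open>e = 0\<close>.  If
  \<open>e \<ge> 1\<close>, all neighbours of \<open>\<sigma>\<close> belong to \<open>M\<close> as well (\<open>le_pancake_dist_neighbour\<close>).  For \<open>e = 1\<close>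
  take \<open>\<sigma>\<close> and its neighbour \<open>\<sigma> r\<^sub>2\<close>.  For \<open>e = 2\<close> take the neighbours \<open>\<sigma> r\<^sub>2\<close> and \<open>\<sigma> r\<^sub>3\<close>: they are
  distinct and not adjacent, since \<open>r\<^sub>2 r\<^sub>3\<close> is not a prefix reversal (\<open>pancake_dist_reversals_2_3\<close>).
\<close>

section \<open>Distances as powers of the adjacency relation\<close>

text \<open>
  Adding the identity to the arcs allows a walk to pause, so that a pair lies in the \<open>k\<close>-th power
  exactly if its distance is \<^emph>\<open>at most\<close> \<open>k\<close>.
\<close>

lemma (in pair_wf_digraph) awalk_iff_relpow:
  assumes "u \<in> pverts G"
  shows "(\<exists>p. awalk u p v \<and> length p \<le> k) \<longleftrightarrow> (u, v) \<in> (Id \<union> parcs G) ^^ k"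
proof
  assume "\<exists>p. awalk u p v \<and> length p \<le> k"
  then obtain p where "awalk u p v" "length p \<le> k"
    by blast
  then show "(u, v) \<in> (Id \<union> parcs G) ^^ k"
  proof (induction k arbitrary: u p)
    case 0
    then show ?case by (simp add: awalk_Nil_iff)
  next
    case (Suc k)
    show ?case
    proof (cases p)
      case Nil
      with Suc.prems have "awalk u [] v"
        by simp
      then have "(u, v) \<in> (Id \<union> parcs G) ^^ k"
        by (rule Suc.IH) simp
      then show ?thesis
        by (rule relpow_Suc_I2[rotated]) simp
    next
      case (Cons e q)
      with Suc.prems have "e \<in> parcs G" "fst e = u" "awalk (snd e) q v" "length q \<le> k"
        by (auto simp: awalk_Cons_iff)
      then have "(u, snd e) \<in> Id \<union> parcs G" "(snd e, v) \<in> (Id \<union> parcs G) ^^ k"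
        using Suc.IH by auto
      then show ?thesis
        by (rule relpow_Suc_I2)
    qed
  qed
next
  assume "(u, v) \<in> (Id \<union> parcs G) ^^ k"
  with assms show "\<exists>p. awalk u p v \<and> length p \<le> k"
  proof (induction k arbitrary: u)
    case 0
    then show ?case by (auto simp: awalk_Nil_iff)
  next
    case (Suc k)
    then obtain w where w: "(u, w) \<in> Id \<union> parcs G" "(w, v) \<in> (Id \<union> parcs G) ^^ k"
      by (meson relpow_Suc_D2)
    show ?case
    proof (cases "u = w")
      case True
      with Suc.IH[OF Suc.prems(1)] w(2) obtain p where "awalk u p v" "length p \<le> k"
        by blast
      then have "awalk u p v \<and> length p \<le> Suc k"
        by simp
      then show ?thesis ..
    next
      case False
      with w have e: "(u, w) \<in> parcs G" by auto
      then have "w \<in> pverts G" using wellformed(2) by fastforce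
      from Suc.IH[OF this w(2)] obtain q where "awalk w q v" "length q \<le> k" by blast
      with e have "awalk u ((u, w) # q) v \<and> length ((u, w) # q) \<le> Suc k"
        by (auto simp: awalk_Cons_iff)
      then show ?thesis ..
    qed
  qed
qed

lemma (in pair_wf_digraph) graph_dist_eq_INF:
  assumes "u \<in> pverts G"
  shows "graph_dist G u v = (INF k\<in>{k. (u, v) \<in> (Id \<union> parcs G) ^^ k}. ereal (real k))"
proof -
  have cost: "awalk_cost (\<lambda>_. 1) p = real (length p)" for p
    by (induction p) auto
  have "graph_dist G u v = (INF p\<in>{p. awalk u p v}. ereal (real (length p)))"
    unfolding graph_dist_def \<mu>_def cost ..
  also have "\<dots> = (INF k\<in>{k. (u, v) \<in> (Id \<union> parcs G) ^^ k}. ereal (real k))"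
  proof (rule INF_eq)
    fix p
    assume "p \<in> {p. awalk u p v}"
    then have "length p \<in> {k. (u, v) \<in> (Id \<union> parcs G) ^^ k}"
      using awalk_iff_relpow[OF assms] by blast
    then show "\<exists>k\<in>{k. (u, v) \<in> (Id \<union> parcs G) ^^ k}. ereal (real k) \<le> ereal (real (length p))"
      by (rule bexI[rotated]) simp
  next
    fix k
    assume "k \<in> {k. (u, v) \<in> (Id \<union> parcs G) ^^ k}"
    then obtain p where "awalk u p v" "length p \<le> k"
      using awalk_iff_relpow[OF assms] by blast
    then show "\<exists>p\<in>{p. awalk u p v}. ereal (real (length p)) \<le> ereal (real k)"
      by (intro bexI[of _ p]) simp_all
  qed
  finally show ?thesis .
qed

lemma Least_mem:
  fixes S :: "nat set"
  assumes "S \<noteq> {}"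
  shows "(LEAST k. k \<in> S) \<in> S"
  using assms by (metis LeastI_ex ex_in_conv)

lemma INF_ereal_nat:
  assumes "S \<noteq> {}"
  shows "(INF k\<in>S. ereal (real k)) = ereal (real (LEAST k. k \<in> S))"
  by (rule INF_eqI) (use Least_mem[OF assms] in \<open>auto intro: Least_le\<close>)

text \<open>
  On permutations of \<open>{1..n}\<close> this is the adjacency relation of the pancake graph with pauses; the pause
  is the reversal of a prefix of length \<open>0\<close> or \<open>1\<close>.  Taking the relation on all functions makes its
  invariance under left composition unconditional, so that \<open>delete_max\<close> below can be studied without
  knowing that its values are permutations.
\<close>

definition flip :: "nat \<Rightarrow> ((nat \<Rightarrow> nat) \<times> (nat \<Rightarrow> nat)) set"
  where "flip n = {(\<pi>, \<pi> \<circ> prefix_reversal i) | \<pi> i. i \<le> n}"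

lemma prefix_reversal_trivial: "i < 2 \<Longrightarrow> prefix_reversal i = id"
  by (auto simp: prefix_reversal_def fun_eq_iff)

lemma flipI: "i \<le> n \<Longrightarrow> (\<pi>, \<pi> \<circ> prefix_reversal i) \<in> flip n"
  by (auto simp: flip_def)

lemma flip_iff:
  assumes "\<pi> permutes {1..n}"
  shows "(\<pi>, \<sigma>) \<in> flip n \<longleftrightarrow> (\<pi>, \<sigma>) \<in> Id \<union> parcs (pancake_graph n)"
proof
  assume "(\<pi>, \<sigma>) \<in> flip n"
  then obtain i where i: "i \<le> n" "\<sigma> = \<pi> \<circ> prefix_reversal i"
    by (auto simp: flip_def)
  with assms show "(\<pi>, \<sigma>) \<in> Id \<union> parcs (pancake_graph n)"
    by (cases "i < 2") (auto simp: prefix_reversal_trivial pancake_graph_def)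
next
  assume "(\<pi>, \<sigma>) \<in> Id \<union> parcs (pancake_graph n)"
  then show "(\<pi>, \<sigma>) \<in> flip n"
    using flipI[of 0 n \<pi>] by (auto simp: pancake_graph_def flipI prefix_reversal_trivial)
qed

lemma flip_permutes: "(\<pi>, \<sigma>) \<in> flip n \<Longrightarrow> \<pi> permutes {1..n} \<Longrightarrow> \<sigma> permutes {1..n}"
  using permutes_compose[OF prefix_reversal_permutes] by (auto simp: flip_def)

lemma relpow_Suc_iff: "(x, z) \<in> R ^^ Suc k \<longleftrightarrow> (\<exists>y. (x, y) \<in> R \<and> (y, z) \<in> R ^^ k)"
  by (meson relpow_Suc_D2 relpow_Suc_I2)

lemma flip_relpow_iff:
  assumes "\<pi> permutes {1..n}"
  shows "(\<pi>, \<sigma>) \<in> flip n ^^ k \<longleftrightarrow> (\<pi>, \<sigma>) \<in> (Id \<union> parcs (pancake_graph n)) ^^ k"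
  using assms
proof (induction k arbitrary: \<pi>)
  case (Suc k)
  then have "(\<pi>, \<rho>) \<in> flip n \<and> (\<rho>, \<sigma>) \<in> flip n ^^ k \<longleftrightarrow>
      (\<pi>, \<rho>) \<in> Id \<union> parcs (pancake_graph n) \<and>
      (\<rho>, \<sigma>) \<in> (Id \<union> parcs (pancake_graph n)) ^^ k" for \<rho>
    using flip_iff flip_permutes by blast
  then show ?case
    unfolding relpow_Suc_iff by simp
qed simp

lemma pancake_dist_eq_INF:
  assumes "\<pi> permutes {1..n}"
  shows "graph_dist (pancake_graph n) \<pi> \<sigma> = (INF k\<in>{k. (\<pi>, \<sigma>) \<in> flip n ^^ k}. ereal (real k))"
proof -
  interpret pair_graph "pancake_graph n"
    by (rule pair_graph_pancake_graph)
  show ?thesis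
    using graph_dist_eq_INF[of \<pi> \<sigma>] assms
    by (simp add: flip_relpow_iff pancake_graph_def)
qed

lemma le_pancake_dist_iff:
  assumes "\<pi> permutes {1..n}"
  shows "ereal (real k) \<le> graph_dist (pancake_graph n) \<pi> \<sigma> \<longleftrightarrow>
    (\<forall>j. (\<pi>, \<sigma>) \<in> flip n ^^ j \<longrightarrow> k \<le> j)"
  unfolding pancake_dist_eq_INF[OF assms] le_INF_iff by simp

lemma pancake_dist_le:
  assumes "\<pi> permutes {1..n}" "(\<pi>, \<sigma>) \<in> flip n ^^ k"
  shows "graph_dist (pancake_graph n) \<pi> \<sigma> \<le> ereal (real k)"
  unfolding pancake_dist_eq_INF[OF assms(1)] using assms by (intro INF_lower) simp

lemma pancake_dist_nonneg:
  assumes "\<pi> permutes {1..n}"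
  shows "0 \<le> graph_dist (pancake_graph n) \<pi> \<sigma>"
  unfolding pancake_dist_eq_INF[OF assms] le_INF_iff by simp

lemma pancake_dist_finite:
  assumes "\<pi> permutes {1..n}" "graph_dist (pancake_graph n) \<pi> \<sigma> \<noteq> \<infinity>"
  obtains k where "graph_dist (pancake_graph n) \<pi> \<sigma> = ereal (real k)" "(\<pi>, \<sigma>) \<in> flip n ^^ k"
proof -
  let ?S = "{k. (\<pi>, \<sigma>) \<in> flip n ^^ k}"
  have dist: "graph_dist (pancake_graph n) \<pi> \<sigma> = (INF k\<in>?S. ereal (real k))"
    by (rule pancake_dist_eq_INF[OF assms(1)])
  have "?S \<noteq> {}"
  proof
    assume "?S = {}"
    with dist assms(2) show False
      by (simp add: top_ereal_def)
  qed
  then have "(LEAST k. k \<in> ?S) \<in> ?S" "(INF k\<in>?S. ereal (real k)) = ereal (real (LEAST k. k \<in> ?S))"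
    by (rule Least_mem, rule INF_ereal_nat)
  then show ?thesis
    using that[OF dist[THEN trans]] by blast
qed

lemma flip_mono:
  assumes "m \<le> n"
  shows "flip m ^^ k \<subseteq> flip n ^^ k"
proof (induction k)
  case (Suc k)
  have "flip m \<subseteq> flip n"
    using assms by (fastforce simp: flip_def)
  with Suc show ?case
    by (auto simp: relcomp_mono)
qed simp

lemma flip_relpow_mono:
  assumes "(\<pi>, \<sigma>) \<in> flip n ^^ j" "j \<le> k"
  shows "(\<pi>, \<sigma>) \<in> flip n ^^ k"
  using assms(2,1)
proof (induction rule: dec_induct)
  case (step i)
  then show ?case
    using flipI[of 0 n \<sigma>] by (auto simp: prefix_reversal_trivial)
qed

lemma flip_relpow_compose: "(\<pi>, \<sigma>) \<in> flip n ^^ k \<Longrightarrow> (\<rho> \<circ> \<pi>, \<rho> \<circ> \<sigma>) \<in> flip n ^^ k"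
proof (induction k arbitrary: \<sigma>)
  case (Suc k)
  from Suc.prems obtain \<tau> where \<tau>: "(\<pi>, \<tau>) \<in> flip n ^^ k" "(\<tau>, \<sigma>) \<in> flip n"
    by (rule relpow_Suc_E)
  from \<tau>(2) have "(\<rho> \<circ> \<tau>, \<rho> \<circ> \<sigma>) \<in> flip n"
    by (auto simp: flip_def comp_assoc)
  with Suc.IH[OF \<tau>(1)] show ?case
    by (rule relpow_Suc_I)
qed simp

lemma finite_pancake_dists:
  assumes "A \<subseteq> {\<pi>. \<pi> permutes {1..n}}"
  shows "finite {graph_dist (pancake_graph n) u v | u v. u \<in> A \<and> v \<in> A}"
proof -
  have "finite A"
    using assms by (rule finite_subset) (simp add: finite_permutations)
  then show ?thesis
    by (rule_tac finite_subset[where B = "(\<lambda>(u, v). graph_dist (pancake_graph n) u v) ` (A \<times> A)"]) auto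
qed

lemma pancake_dist_le_diameter:
  assumes "\<pi> permutes {1..n}" "\<sigma> permutes {1..n}"
  shows "graph_dist (pancake_graph n) \<pi> \<sigma> \<le> graph_diameter (pancake_graph n)"
  unfolding graph_diameter_def
  using assms by (intro Max_ge finite_pancake_dists) (auto simp: pancake_graph_def)

text \<open>
  Left multiplication is an automorphism of the Cayley graph, so a pair at maximal distance can be moved
  to one that starts at the identity.
\<close>

lemma pancake_diameter_attained:
  obtains \<sigma> where "\<sigma> permutes {1..n}"
    "graph_diameter (pancake_graph n) = graph_dist (pancake_graph n) id \<sigma>"
proof -
  let ?V = "pverts (pancake_graph n)"
  let ?D = "{graph_dist (pancake_graph n) u v | u v. u \<in> ?V \<and> v \<in> ?V}"
  have "id \<in> ?V"
    by (simp add: pancake_graph_def permutes_id)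
  then have "?D \<noteq> {}"
    by blast
  moreover have "finite ?D"
    by (rule finite_pancake_dists) (simp add: pancake_graph_def)
  ultimately have "Max ?D \<in> ?D"
    by (rule Max_in[rotated])
  then obtain \<pi> \<sigma> where \<pi>: "\<pi> permutes {1..n}" and \<sigma>: "\<sigma> permutes {1..n}"
    and diam: "graph_diameter (pancake_graph n) = graph_dist (pancake_graph n) \<pi> \<sigma>"
    unfolding graph_diameter_def by (auto simp: pancake_graph_def)
  have "(\<pi>, \<sigma>) \<in> flip n ^^ k \<longleftrightarrow> (id, inv \<pi> \<circ> \<sigma>) \<in> flip n ^^ k" for k
    using flip_relpow_compose[of \<pi> \<sigma> k n "inv \<pi>"] flip_relpow_compose[of id "inv \<pi> \<circ> \<sigma>" k n \<pi>]
      permutes_inv_o[OF \<pi>] by (auto simp: comp_assoc[symmetric])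
  then have "graph_diameter (pancake_graph n) = graph_dist (pancake_graph n) id (inv \<pi> \<circ> \<sigma>)"
    using \<pi> by (simp add: diam pancake_dist_eq_INF permutes_id)
  moreover have "(inv \<pi> \<circ> \<sigma>) permutes {1..n}"
    using \<pi> \<sigma> by (intro permutes_compose permutes_inv)
  ultimately show ?thesis
    using that by blast
qed

section \<open>Comparing consecutive diameters\<close>

text \<open>
  The one-line notation with the entry \<open>n\<close> removed; \<open>inv \<pi> n\<close> is the position of that entry.
\<close>

definition delete_max :: "nat \<Rightarrow> (nat \<Rightarrow> nat) \<Rightarrow> nat \<Rightarrow> nat"
  where "delete_max n \<pi> j = (if n \<le> j then j else if j < inv \<pi> n then \<pi> j else \<pi> (j + 1))"

text \<open>
  Reversing a prefix and then deleting \<open>n\<close> is the same as deleting \<open>n\<close> first and reversing what remains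
  of the prefix, which is shorter by one exactly if the prefix contained \<open>n\<close>.
\<close>

lemma flip_delete_max:
  assumes "\<pi> permutes {1..n}" "(\<pi>, \<sigma>) \<in> flip n"
  shows "(delete_max n \<pi>, delete_max n \<sigma>) \<in> flip (n - 1)"
proof -
  define p where "p = inv \<pi> n"
  obtain i where i: "i \<le> n" "\<sigma> = \<pi> \<circ> prefix_reversal i"
    using assms(2) by (auto simp: flip_def)
  have "inv (prefix_reversal i) = prefix_reversal i"
    using prefix_reversal_involution by (simp add: inv_unique_comp)
  moreover have "bij \<pi>" "bij (prefix_reversal i)"
    using assms(1) prefix_reversal_involution o_bij by (auto simp: permutes_bij)
  ultimately have inv_\<sigma>: "inv \<sigma> n = prefix_reversal i p"
    by (simp add: i(2) o_inv_distrib p_def)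
  define i' where "i' = (if i < p then i else i - 1)"
  have p0: "p \<le> n \<and> (0 < n \<longrightarrow> 0 < p)"
  proof (cases "n = 0")
    case True
    with assms(1) show ?thesis
      by (simp add: p_def permutes_empty)
  next
    case False
    then show ?thesis
      using permutes_in_image[OF permutes_inv[OF assms(1)], of n] by (simp add: p_def)
  qed
  have "delete_max n \<sigma> j = delete_max n \<pi> (prefix_reversal i' j)" for j
    using i(1) p0
    unfolding delete_max_def inv_\<sigma> p_def[symmetric] unfolding i(2)
    by (auto simp: prefix_reversal_def i'_def intro!: arg_cong[where f = \<pi>])
  moreover have "i' \<le> n - 1"
    using i(1) p0 by (auto simp: i'_def)
  ultimately show ?thesis
    using flipI[of i' "n - 1" "delete_max n \<pi>"] by (metis comp_def ext)
qed

lemma flip_relpow_delete_max: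
  assumes "\<pi> permutes {1..n}" "(\<pi>, \<sigma>) \<in> flip n ^^ k"
  shows "(delete_max n \<pi>, delete_max n \<sigma>) \<in> flip (n - 1) ^^ k"
  using assms
proof (induction k arbitrary: \<pi>)
  case (Suc k)
  then obtain \<rho> where "(\<pi>, \<rho>) \<in> flip n" "(\<rho>, \<sigma>) \<in> flip n ^^ k"
    by (meson relpow_Suc_D2)
  with Suc show ?case
    by (blast intro: flip_delete_max flip_permutes relpow_Suc_I2)
qed simp

lemma delete_max_permutes:
  assumes "\<pi> permutes {1..n - 1}"
  shows "delete_max n \<pi> = \<pi>"
proof -
  have "\<pi> j = j" if "n \<le> j" for j
    using that assms by (cases n) (auto simp: permutes_def)
  moreover from this have "inv \<pi> n = n"
    using permutes_inv_eq[OF assms] by auto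
  ultimately show ?thesis
    by (auto simp: delete_max_def fun_eq_iff)
qed

text \<open>
  Permutations of \<open>{1..n - 1}\<close> are fixed by \<open>delete_max n\<close>, so \<open>P\<^bsub>n-1\<^esub>\<close> is a retract of \<open>P\<^sub>n\<close> and its
  distances do not shrink inside the larger graph.
\<close>

lemma pancake_diameter_mono:
  "graph_diameter (pancake_graph (n - 1)) \<le> graph_diameter (pancake_graph n)"
proof -
  obtain \<sigma> where \<sigma>: "\<sigma> permutes {1..n - 1}"
    "graph_diameter (pancake_graph (n - 1)) = graph_dist (pancake_graph (n - 1)) id \<sigma>"
    by (rule pancake_diameter_attained)
  have \<sigma>_n: "\<sigma> permutes {1..n}"
    using \<sigma>(1) by (rule permutes_subset) auto
  have "(id, \<sigma>) \<in> flip (n - 1) ^^ k" if "(id, \<sigma>) \<in> flip n ^^ k" for k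
    using flip_relpow_delete_max[OF permutes_id that] \<sigma>(1)
    by (simp add: delete_max_permutes permutes_id)
  then have "graph_dist (pancake_graph (n - 1)) id \<sigma> \<le> graph_dist (pancake_graph n) id \<sigma>"
    by (auto simp: pancake_dist_eq_INF permutes_id intro: INF_superset_mono)
  with \<sigma>(2) show ?thesis
    using pancake_dist_le_diameter[OF permutes_id \<sigma>_n] by auto
qed

lemma pancake_diameter_le_plus_2:
  assumes n: "0 < n" and diam: "graph_diameter (pancake_graph (n - 1)) = ereal (real k)"
  shows "graph_diameter (pancake_graph n) \<le> ereal (real (k + 2))"
proof -
  obtain \<sigma> where \<sigma>: "\<sigma> permutes {1..n}"
    "graph_diameter (pancake_graph n) = graph_dist (pancake_graph n) id \<sigma>"
    by (rule pancake_diameter_attained)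
  define p where "p = inv \<sigma> n"
  have p: "p \<in> {1..n}" "\<sigma> p = n"
    using n permutes_in_image[OF permutes_inv[OF \<sigma>(1)], of n] permutes_inverses(1)[OF \<sigma>(1)]
    by (auto simp: p_def)
  \<comment> \<open>The reversal at \<open>p\<close> brings \<open>n\<close> to the front, the full reversal sends it to the end.\<close>
  define \<tau> where "\<tau> = \<sigma> \<circ> prefix_reversal p \<circ> prefix_reversal n"
  have "\<tau> permutes {1..n}"
    unfolding \<tau>_def using p \<sigma>(1) by (intro permutes_compose prefix_reversal_permutes) auto
  moreover have "\<tau> n = n"
    using p by (auto simp: \<tau>_def prefix_reversal_def)
  ultimately have \<tau>: "\<tau> permutes {1..n - 1}"
    using n by (auto simp: permutes_def) (metis Suc_leI Suc_pred le_antisym not_less_eq_eq)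
  from pancake_dist_le_diameter[OF permutes_id \<tau>] diam
  have le: "graph_dist (pancake_graph (n - 1)) id \<tau> \<le> ereal (real k)"
    by simp
  then have "graph_dist (pancake_graph (n - 1)) id \<tau> \<noteq> \<infinity>"
    by auto
  then obtain j where "graph_dist (pancake_graph (n - 1)) id \<tau> = ereal (real j)"
    and j: "(id, \<tau>) \<in> flip (n - 1) ^^ j"
    by (rule pancake_dist_finite[OF permutes_id])
  with le have "j \<le> k"
    by simp
  with j have "(id, \<tau>) \<in> flip (n - 1) ^^ k"
    by (rule flip_relpow_mono)
  then have "(id, \<tau>) \<in> flip n ^^ k"
    using flip_mono[of "n - 1" n] by auto
  moreover have "(\<tau>, \<tau> \<circ> prefix_reversal n) \<in> flip n"
    by (rule flipI) simp
  moreover have "(\<tau> \<circ> prefix_reversal n, \<tau> \<circ> prefix_reversal n \<circ> prefix_reversal p) \<in> flip n"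
    using p by (intro flipI) simp
  moreover have "\<tau> \<circ> prefix_reversal n \<circ> prefix_reversal p = \<sigma>"
    by (simp add: \<tau>_def comp_assoc prefix_reversal_involution)
  ultimately have "(id, \<sigma>) \<in> flip n ^^ (k + 2)"
    by (auto simp: numeral_2_eq_2)
  then show ?thesis
    unfolding \<sigma>(2) by (rule pancake_dist_le[OF permutes_id])
qed

section \<open>Distances between neighbours of an antipode\<close>

lemma le_pancake_dist_neighbour:
  assumes dist: "ereal (real (k + 1)) \<le> graph_dist (pancake_graph n) id \<sigma>" and i: "i \<le> n"
  shows "ereal (real k) \<le> graph_dist (pancake_graph n) id (\<sigma> \<circ> prefix_reversal i)"
proof -
  have "k \<le> j" if "(id, \<sigma> \<circ> prefix_reversal i) \<in> flip n ^^ j" for j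
  proof -
    have "(\<sigma> \<circ> prefix_reversal i, \<sigma>) \<in> flip n"
      using flipI[OF i, of "\<sigma> \<circ> prefix_reversal i"]
      by (simp add: comp_assoc prefix_reversal_involution)
    with that have "(id, \<sigma>) \<in> flip n ^^ (Suc j)"
      by auto
    then have "k + 1 \<le> Suc j"
      using dist unfolding le_pancake_dist_iff[OF permutes_id] by blast
    then show ?thesis
      by simp
  qed
  then show ?thesis
    by (simp add: le_pancake_dist_iff permutes_id)
qed

lemma pancake_dist_reversal_2:
  assumes \<sigma>: "\<sigma> permutes {1..n}"
  shows "ereal (real 1) \<le> graph_dist (pancake_graph n) \<sigma> (\<sigma> \<circ> prefix_reversal 2)"
proof -
  have "\<sigma> \<noteq> \<sigma> \<circ> prefix_reversal 2"
  proof
    assume "\<sigma> = \<sigma> \<circ> prefix_reversal 2"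
    then have "\<sigma> 1 = (\<sigma> \<circ> prefix_reversal 2) 1"
      by (rule fun_cong)
    then have "\<sigma> 1 = \<sigma> 2"
      by (simp add: prefix_reversal_def)
    with permutes_inj[OF \<sigma>] have "(1 :: nat) = 2"
      by (rule injD)
    then show False
      by simp
  qed
  then have "1 \<le> j" if "(\<sigma>, \<sigma> \<circ> prefix_reversal 2) \<in> flip n ^^ j" for j
    using that by (cases j) auto
  then show ?thesis
    using \<sigma> by (simp only: le_pancake_dist_iff) blast
qed

lemma pancake_dist_reversals_2_3:
  assumes \<sigma>: "\<sigma> permutes {1..n}" and n: "2 \<le> n"
  shows "ereal (real 2) \<le>
    graph_dist (pancake_graph n) (\<sigma> \<circ> prefix_reversal 2) (\<sigma> \<circ> prefix_reversal 3)"
proof -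
  have no_arc: "(\<sigma> \<circ> prefix_reversal 2, \<sigma> \<circ> prefix_reversal 3) \<notin> flip n"
  proof
    assume "(\<sigma> \<circ> prefix_reversal 2, \<sigma> \<circ> prefix_reversal 3) \<in> flip n"
    then obtain i where "\<sigma> \<circ> prefix_reversal 3 = \<sigma> \<circ> prefix_reversal 2 \<circ> prefix_reversal i"
      by (auto simp: flip_def)
    then have eq: "prefix_reversal 3 j = prefix_reversal 2 (prefix_reversal i j)" for j
      using permutes_inj[OF \<sigma>] by (metis comp_apply injD)
    \<comment> \<open>The value at \<open>1\<close> forces \<open>r\<^sub>i = r\<^sub>3\<close>, which is then refuted at \<open>2\<close>.\<close>
    from eq[of 1] have "i = 3"
      by (simp add: prefix_reversal_def split: if_splits)
    with eq[of 2] show False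
      by (simp add: prefix_reversal_def)
  qed
  moreover have "\<sigma> \<circ> prefix_reversal 2 \<noteq> \<sigma> \<circ> prefix_reversal 3"
    using no_arc flipI[of 0 n "\<sigma> \<circ> prefix_reversal 2"] by (auto simp: prefix_reversal_trivial)
  ultimately have "2 \<le> j"
    if "(\<sigma> \<circ> prefix_reversal 2, \<sigma> \<circ> prefix_reversal 3) \<in> flip n ^^ j" for j
    using that by (cases j; cases "j - 1") auto
  moreover have "(\<sigma> \<circ> prefix_reversal 2) permutes {1..n}"
    using \<sigma> n by (intro permutes_compose prefix_reversal_permutes)
  ultimately show ?thesis
    by (simp only: le_pancake_dist_iff) blast
qed

theorem mainTheorem1:
  fixes n :: nat and M :: "(nat \<Rightarrow> nat) set" and d :: ereal
  assumes "n > 5"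
    and "M = {u. u permutes {1..n} \<and>
               graph_dist (pancake_graph n) id u \<ge> graph_diameter (pancake_graph (n - 1))}"
    and "d = Max {graph_dist (pancake_graph n) u v | u v. u \<in> M \<and> v \<in> M}"
  shows "graph_diameter (pancake_graph n) \<le> graph_diameter (pancake_graph (n - 1)) + d"
proof (cases "graph_diameter (pancake_graph (n - 1)) = \<infinity>")
  case False
  \<comment> \<open>In the excluded case the right-hand side is infinite whatever \<open>d\<close> is.\<close>
  let ?P = "pancake_graph n"
  obtain k where k: "graph_diameter (pancake_graph (n - 1)) = ereal (real k)"
    using False pancake_diameter_attained[of "n - 1"] pancake_dist_finite[OF permutes_id] by metis
  have upper: "graph_diameter ?P \<le> ereal (real (k + 2))"
    using assms(1) k by (intro pancake_diameter_le_plus_2) auto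
  obtain \<sigma> where \<sigma>: "\<sigma> permutes {1..n}" "graph_diameter ?P = graph_dist ?P id \<sigma>"
    by (rule pancake_diameter_attained)
  with upper have "graph_dist ?P id \<sigma> \<noteq> \<infinity>"
    by auto
  then obtain m where m: "graph_dist ?P id \<sigma> = ereal (real m)"
    by (rule pancake_dist_finite[OF permutes_id])
  have "k \<le> m" "m \<le> k + 2"
    using pancake_diameter_mono[of n] upper unfolding k \<sigma>(2) m by simp_all
  have M_iff: "\<tau> \<in> M \<longleftrightarrow> \<tau> permutes {1..n} \<and> ereal (real k) \<le> graph_dist ?P id \<tau>" for \<tau>
    unfolding assms(2) k by simp
  have le_d: "graph_dist ?P \<tau> \<rho> \<le> d" if "\<tau> \<in> M" "\<rho> \<in> M" for \<tau> \<rho>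
    unfolding assms(3)
  proof (rule Max_ge)
    have "M \<subseteq> {\<pi>. \<pi> permutes {1..n}}"
      using M_iff by blast
    then show "finite {graph_dist ?P u v | u v. u \<in> M \<and> v \<in> M}"
      by (rule finite_pancake_dists)
  qed (use that in blast)
  have \<sigma>_M: "\<sigma> \<in> M"
    using \<sigma>(1) m \<open>k \<le> m\<close> by (simp add: M_iff)
  have neighbour_M: "\<sigma> \<circ> prefix_reversal i \<in> M" if "k + 1 \<le> m" "i \<le> n" for i
    unfolding M_iff using that m \<sigma>(1)
    by (intro conjI le_pancake_dist_neighbour permutes_compose prefix_reversal_permutes) auto
  from \<open>k \<le> m\<close> \<open>m \<le> k + 2\<close> consider "m = k" | "m = k + 1" | "m = k + 2"
    by linarith
  then have "ereal (real (m - k)) \<le> d"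
  proof cases
    case 1
    then show ?thesis
      using order_trans[OF pancake_dist_nonneg[OF \<sigma>(1)] le_d[OF \<sigma>_M \<sigma>_M]]
      by (simp add: zero_ereal_def)
  next
    case 2
    then show ?thesis
      using order_trans[OF pancake_dist_reversal_2[OF \<sigma>(1)] le_d[OF \<sigma>_M neighbour_M]] assms(1)
      by simp
  next
    case 3
    then show ?thesis
      using order_trans[OF pancake_dist_reversals_2_3[OF \<sigma>(1)] le_d[OF neighbour_M neighbour_M]]
        assms(1) by simp
  qed
  then have "ereal (real k) + ereal (real (m - k)) \<le> ereal (real k) + d"
    by (rule add_left_mono)
  with \<open>k \<le> m\<close> show ?thesis
    unfolding k \<sigma>(2) m by simp
qed simp

end
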